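(* For each integer $m\ge 2$ let $$T_{m}=\{a\in\mathbb{Z}:\ 1\le a\le m^{2},\ \gcd(a,m)=1,\ m \text{ is a Carmichael-Wieferich number with base } a\}.$$ Then $$\lim_{m\to \infty}\frac{|T_{m}|}{\varphi(m^{2})}=0.$$
   Context: $\varphi$ is Euler's totient function. $\lambda$ denotes the Carmichael function: $\lambda(m)$ is the exponent of the multiplicative group $(\mathbb{Z}/m\mathbb{Z})^{*}$. For coprime integers $m\ge 2$ and $a$, the Carmichael quotient is the integer $C_{m}(a)=\frac{a^{\lambda(m)}-1}{m}$; $m$ is called a Carmichael-Wieferich number with base $a$ if $C_{m}(a)\equiv 0\pmod m$. *)

theory Defs
  imports Complex_Main "HOL-Number_Theory.Number_Theory"
begin

text \<open>
  \<^const>\<open>Carmichael\<close> is the exponent of the unit group of the integers modulo \<open>m\<close>.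
  For coprime \<open>a\<close> and \<open>m\<close> the division below is exact; see
  \<open>Carmichael_quotient_mult\<close>.
\<close>

definition Carmichael_quotient :: "nat \<Rightarrow> int \<Rightarrow> int" where
  "Carmichael_quotient m a = (a ^ Carmichael m - 1) div int m"

lemma Carmichael_quotient_mult:
  assumes "m \<ge> 2" "coprime (int m) a"
  shows "int m * Carmichael_quotient m a = a ^ Carmichael m - 1"
proof -
  define b where "b = nat (a mod int m)"
  have b: "int b = a mod int m"
    using assms(1) by (simp add: b_def)
  have "coprime (int m) (int b)"
    using assms by (simp add: b)
  hence "coprime m b" by simp
  hence "[b ^ Carmichael m = 1] (mod m)"
    by (intro Carmichael_divides) auto
  hence "[int b ^ Carmichael m = 1] (mod int m)"
    by (metis cong_int_iff of_nat_1 of_nat_power)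
  moreover have "[int b ^ Carmichael m = a ^ Carmichael m] (mod int m)"
    unfolding b by (intro cong_pow) (simp add: cong_def)
  ultimately have "[a ^ Carmichael m = 1] (mod int m)"
    using cong_sym cong_trans by blast
  hence "int m dvd a ^ Carmichael m - 1"
    by (simp add: cong_iff_dvd_diff)
  thus ?thesis
    by (simp add: Carmichael_quotient_def)
qed

definition Carmichael_Wieferich :: "nat \<Rightarrow> int \<Rightarrow> bool" where
  "Carmichael_Wieferich m a \<longleftrightarrow>
     m \<ge> 2 \<and> coprime (int m) a \<and> [Carmichael_quotient m a = 0] (mod int m)"

definition T :: "nat \<Rightarrow> int set" where
  "T m = {a. 1 \<le> a \<and> a \<le> (int m)\<^sup>2 \<and> gcd a (int m) = 1 \<and> Carmichael_Wieferich m a}"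

end

theory Submission
  imports Defs
begin

text \<open>
  Let \<open>p ^ \<alpha>\<close> be the largest prime power exactly dividing \<open>m = p ^ \<alpha> * n\<close>. Every prime factor
  of \<open>m\<close> is at most \<open>p ^ \<alpha>\<close>, so by the closed formula for \<open>Carmichael m\<close> the exponent \<open>v\<close> of \<open>p\<close>
  in it is less than \<open>\<alpha>\<close>. Two elements of \<open>T m\<close> congruent modulo \<open>p\<close> (modulo 4 if \<open>p = 2\<close>) have
  \<open>Carmichael m\<close>-th powers that agree modulo \<open>p ^ (2 * \<alpha>)\<close>, so by lifting the exponent they
  agree modulo \<open>p ^ (2 * \<alpha> - v)\<close>. Counting residues modulo \<open>p ^ (2 * \<alpha>)\<close> and \<open>n\<^sup>2\<close> bounds the
  ratio by \<open>4 / p ^ \<alpha>\<close>. Finally \<open>m \<le> Q ^ Q\<close> for \<open>Q = p ^ \<alpha>\<close>, so \<open>Q\<close> tends to infinity with \<open>m\<close>.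
\<close>

section \<open>Lifting the exponent\<close>

text \<open>Modulo \<open>p\<close> every term of the sum becomes \<open>b ^ n\<close>. The sum is
  the cofactor of \<open>a - b\<close> in \<open>a ^ Suc n - b ^ Suc n\<close>, so for a prime
  \<open>p\<close> dividing neither \<open>Suc n\<close> nor \<open>b\<close> this cofactor is prime
  to \<open>p\<close>.\<close>

lemma sum_powers_cong:
  fixes a b p :: int
  assumes "p dvd a - b"
  shows "[(\<Sum>i<Suc n. a ^ i * b ^ (n - i)) = of_nat (Suc n) * b ^ n] (mod p)"
proof -
  have "[a = b] (mod p)"
    using assms by (simp add: cong_iff_dvd_diff)
  hence "[(\<Sum>i<Suc n. a ^ i * b ^ (n - i)) = (\<Sum>i<Suc n. b ^ i * b ^ (n - i))] (mod p)"
    by (intro cong_sum cong_mult cong_pow) auto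
  also have "(\<Sum>i<Suc n. b ^ i * b ^ (n - i)) = (\<Sum>i<Suc n. b ^ n)"
    by (intro sum.cong) (auto simp flip: power_add)
  finally show ?thesis by simp
qed

text \<open>Binomial expansion of \<open>(b + c) ^ i\<close> up to the linear term. The extra factor
  \<open>b\<close> on the left avoids the exponent \<open>i - 1\<close>, which would be truncated at
  \<open>i = 0\<close>.\<close>

lemma power_add_cong_square:
  fixes b c :: int
  shows "[b * (b + c) ^ i = b ^ i * (b + int i * c)] (mod c\<^sup>2)"
proof (induction i)
  case (Suc i)
  have "[(b + c) * (b * (b + c) ^ i) = (b + c) * (b ^ i * (b + int i * c))] (mod c\<^sup>2)"
    using Suc by (rule cong_scalar_left)
  moreover have "(b + c) * (b ^ i * (b + int i * c)) - b ^ Suc i * (b + int (Suc i) * c)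
      = c\<^sup>2 * (b ^ i * int i)"
    by (simp add: algebra_simps power2_eq_square)
  hence "[(b + c) * (b ^ i * (b + int i * c)) = b ^ Suc i * (b + int (Suc i) * c)] (mod c\<^sup>2)"
    by (simp add: cong_iff_dvd_diff)
  ultimately show ?case
    using cong_trans by (metis mult.left_commute power_Suc)
qed simp

text \<open>The sum is the cofactor of \<open>a - b\<close> in \<open>a ^ p - b ^ p\<close>. For odd
  \<open>p\<close>, expanding around \<open>b\<close> shows that \<open>b\<close> times the sum is
  \<open>p * b ^ (p - 1) * (b + c * h)\<close> modulo p^2, where \<open>c = a - b\<close> is
  divisible by \<open>p\<close> and \<open>h = (p - 1) / 2\<close>; the factors after
  \<open>p\<close> are prime to \<open>p\<close>.\<close>

lemma square_prime_not_dvd_sum_powers: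
  fixes a b :: int and p :: nat
  assumes p: "prime p" and ab: "int p dvd a - b" "p = 2 \<Longrightarrow> 4 dvd a - b"
    and b: "\<not> int p dvd b"
  shows "\<not> (int p)\<^sup>2 dvd (\<Sum>i<p. a ^ i * b ^ (p - Suc i))"
proof
  assume dvd: "(int p)\<^sup>2 dvd (\<Sum>i<p. a ^ i * b ^ (p - Suc i))"
  show False
  proof (cases "p = 2")
    case True
    \<comment> \<open>For \<open>p = 2\<close> the sum is \<open>a + b\<close>; together with 4
      dividing \<open>a - b\<close> this makes 4 divide \<open>2 * b\<close>.\<close>
    have "4 dvd a + b"
      using dvd True by (simp add: lessThan_nat_numeral add.commute)
    with ab(2)[OF True] have "2 dvd b" by presburger
    with b True show False by simp
  next
    case False
    with p have "odd p"
      using prime_prime_factor two_is_prime_nat primes_dvd_imp_eq by blast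
    then obtain h where h: "p = 2 * h + 1" by (elim oddE)
    define c where "c = a - b"
    have a: "a = b + c" by (simp add: c_def)
    have c: "int p dvd c" using ab by (simp add: c_def)
    hence c2: "(int p)\<^sup>2 dvd c\<^sup>2" by (rule dvd_power_same)
    have "[b * a ^ i = b ^ i * (b + int i * c)] (mod (int p)\<^sup>2)" for i
      unfolding a using power_add_cong_square c2 by (rule cong_dvd_modulus)
    hence "[(\<Sum>i<p. (b * a ^ i) * b ^ (p - Suc i))
        = (\<Sum>i<p. (b ^ i * (b + int i * c)) * b ^ (p - Suc i))] (mod (int p)\<^sup>2)"
      by (intro cong_sum cong_scalar_right)
    also have "(\<Sum>i<p. (b ^ i * (b + int i * c)) * b ^ (p - Suc i))
        = (\<Sum>i<p. b ^ (p - 1) * (b + int i * c))"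
    proof (intro sum.cong refl)
      fix i assume "i \<in> {..<p}"
      hence "b ^ (p - 1) = b ^ i * b ^ (p - Suc i)"
        by (auto simp flip: power_add)
      thus "(b ^ i * (b + int i * c)) * b ^ (p - Suc i) = b ^ (p - 1) * (b + int i * c)"
        by simp
    qed
    also have "\<dots> = b ^ (p - 1) * (int p * b + c * (\<Sum>i<p. int i))"
      by (simp only: sum_distrib_left[symmetric] sum.distrib) (simp add: sum_distrib_left mult.commute)
    \<comment> \<open>Oddness of \<open>p\<close> enters here: \<open>p * (p - 1) / 2\<close> is a
      multiple of \<open>p\<close>.\<close>
    also have "(\<Sum>i<p. int i) = int p * int h"
      unfolding h by (induction h) (auto simp: algebra_simps)
    finally have "[b * (\<Sum>i<p. a ^ i * b ^ (p - Suc i))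
        = b ^ (p - 1) * (int p * b + c * (int p * int h))] (mod (int p)\<^sup>2)"
      by (simp add: sum_distrib_left mult.assoc)
    with dvd have "(int p)\<^sup>2 dvd b ^ (p - 1) * (int p * b + c * (int p * int h))"
      using cong_dvd_iff dvd_mult by blast
    also have "b ^ (p - 1) * (int p * b + c * (int p * int h))
        = int p * (b ^ (p - 1) * (b + c * int h))"
      by (simp add: algebra_simps)
    finally have "int p dvd b ^ (p - 1) * (b + c * int h)"
      using p by (simp add: power2_eq_square)
    moreover have "prime (int p)" using p by simp
    ultimately have "int p dvd b \<or> int p dvd b + c * int h"
      using prime_dvd_mult_iff prime_dvd_power by blast
    with b c show False
      by (metis dvd_add_left_iff dvd_mult2)
  qed
qed

text \<open>Induction on \<open>v\<close>, passing from \<open>a\<close>, \<open>b\<close> to their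
  \<open>p\<close>-th powers: each such passage adds at most one factor \<open>p\<close> to the
  difference, and the remaining exponent \<open>u\<close>, prime to \<open>p\<close>, adds none.
  Putting \<open>p ^ v\<close> on the right-hand side avoids truncated subtraction and also covers
  \<open>a = b\<close>.\<close>

lemma lifting_the_exponent_aux:
  fixes a b :: int and p u v k :: nat
  assumes p: "prime p" and "int p dvd a - b" "p = 2 \<Longrightarrow> 4 dvd a - b"
    and "\<not> int p dvd b" and u: "\<not> p dvd u"
    and "int p ^ k dvd a ^ (p ^ v * u) - b ^ (p ^ v * u)"
  shows "int p ^ k dvd (a - b) * int p ^ v"
  using assms(2-4,6)
proof (induction v arbitrary: a b)
  case 0
  have pp: "prime (int p)" using p by simp
  obtain w where w: "u = Suc w" using u by (cases u) auto
  let ?S = "\<Sum>i<Suc w. a ^ i * b ^ (w - i)"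
  have "[?S = int u * b ^ w] (mod int p)"
    using sum_powers_cong[OF "0.prems"(1), of w] unfolding w .
  moreover have "\<not> int p dvd int u * b ^ w"
    using u "0.prems"(3) pp by (auto simp: prime_dvd_mult_iff dest: prime_dvd_power[OF pp])
  ultimately have S: "\<not> int p dvd ?S"
    using cong_dvd_iff by blast
  have "int p ^ k dvd ?S * (a - b)"
    using "0.prems"(4) unfolding w by (simp add: diff_power_eq_sum mult.commute del: power_Suc)
  with S pp show ?case
    by (cases "k = 0") (auto intro: prime_power_dvd_multD[of "int p"])
next
  case (Suc v)
  have pp: "prime (int p)" using p by simp
  let ?S = "\<Sum>i<p. a ^ i * b ^ (p - Suc i)"
  obtain w where w: "p = Suc w" using p by (cases p) auto
  have eq: "a ^ p - b ^ p = (a - b) * ?S"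
    unfolding w by (simp only: diff_power_eq_sum diff_Suc_Suc)
  have "int p ^ k dvd (a ^ p - b ^ p) * int p ^ v"
  proof (rule Suc.IH)
    show "int p dvd a ^ p - b ^ p" "p = 2 \<Longrightarrow> 4 dvd a ^ p - b ^ p"
      using Suc.prems unfolding eq by auto
    show "\<not> int p dvd b ^ p"
      using Suc.prems(3) pp prime_dvd_power by blast
    show "int p ^ k dvd (a ^ p) ^ (p ^ v * u) - (b ^ p) ^ (p ^ v * u)"
      using Suc.prems(4) by (simp add: mult.assoc flip: power_mult)
  qed
  hence dvd: "int p ^ k dvd ?S * ((a - b) * int p ^ v)"
    unfolding eq by (simp add: mult_ac)
  have S: "\<not> (int p)\<^sup>2 dvd ?S"
    using square_prime_not_dvd_sum_powers[OF p] Suc.prems by blast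
  \<comment> \<open>Split off the power of \<open>p\<close> in \<open>?S\<close>: the part
    \<open>t\<close> prime to \<open>p\<close> can be cancelled, and \<open>p ^ e\<close> costs at
    most one factor \<open>p\<close>.\<close>
  obtain t e where t: "?S = int p ^ e * t" "\<not> int p dvd t" "e \<le> 1"
  proof (cases "int p dvd ?S")
    case True
    then obtain t where "?S = int p * t" by (elim dvdE)
    with S that[of 1 t] show ?thesis by (auto simp: power2_eq_square)
  next
    case False
    with that[of 0 ?S] show ?thesis by simp
  qed
  have "int p ^ k dvd t * ((a - b) * int p ^ (e + v))"
    using dvd unfolding t(1) by (simp add: mult_ac power_add)
  hence "int p ^ k dvd (a - b) * int p ^ (e + v)"
    using t(2) pp by (cases "k = 0") (auto intro: prime_power_dvd_multD[of "int p"])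
  also have "\<dots> dvd (a - b) * int p ^ Suc v"
    using t(3) by (intro mult_dvd_mono le_imp_power_dvd) auto
  finally show ?case .
qed

lemma lifting_the_exponent:
  fixes a b :: int and p n k :: nat
  assumes p: "prime p" and "int p dvd a - b" "p = 2 \<Longrightarrow> 4 dvd a - b"
    and "\<not> int p dvd b" and "n > 0" and "int p ^ k dvd a ^ n - b ^ n"
  shows "int p ^ (k - multiplicity p n) dvd a - b"
proof -
  let ?v = "multiplicity p n"
  obtain u where u: "n = p ^ ?v * u" "\<not> p dvd u"
    using multiplicity_decompose'[of n p] assms by (metis not_prime_unit not_gr0)
  have *: "int p ^ k dvd (a - b) * int p ^ ?v"
    using lifting_the_exponent_aux[OF assms(1-4) u(2), of k ?v] assms(6) u(1) by simp
  show ?thesis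
  \<comment> \<open>If \<open>?v > k\<close>, the truncated exponent is 0 and the claim is
    trivial.\<close>
  proof (cases "?v \<le> k")
    case True
    hence "int p ^ (k - ?v) * int p ^ ?v dvd (a - b) * int p ^ ?v"
      using * by (simp flip: power_add)
    thus ?thesis using p by simp
  qed simp
qed

section \<open>The multiplicity of the dominant prime in the Carmichael function\<close>

text \<open>The multiplicity of \<open>p\<close> in a least common multiple is the maximum of the
  multiplicities; excluding 0 from \<open>A\<close> keeps the \<open>Lcm\<close> nonzero, so that
  multiplicities characterise divisibility.\<close>

lemma prime_power_dvd_LcmD:
  fixes A :: "nat set"
  assumes "finite A" "prime p" "p ^ k dvd Lcm A" "k > 0" "0 \<notin> A"
  shows "\<exists>x\<in>A. p ^ k dvd x"
  using assms
proof (induction A rule: finite_induct)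
  case empty
  thus ?case using prime_gt_1_nat by fastforce
next
  case (insert x A)
  have "x \<noteq> 0" "Lcm A \<noteq> 0"
    using insert by (auto simp: Lcm_0_iff)
  hence "multiplicity p (Lcm (insert x A)) = max (multiplicity p x) (multiplicity p (Lcm A))"
    using insert.prems by (simp add: multiplicity_lcm)
  hence "p ^ k dvd x \<or> p ^ k dvd Lcm A"
    using insert.prems(1,2) \<open>x \<noteq> 0\<close> \<open>Lcm A \<noteq> 0\<close>
      power_dvd_iff_le_multiplicity[of "lcm x (Lcm A)" p k]
      power_dvd_iff_le_multiplicity[of x p k] power_dvd_iff_le_multiplicity[of "Lcm A" p k]
      prime_gt_1_nat[of p] by (auto simp: le_max_iff_disj lcm_eq_0_iff)
  thus ?case using insert by auto
qed

text \<open>\<open>Carmichael m\<close> is the \<open>Lcm\<close> of the exponents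
  \<open>?f r\<close> belonging to the prime power components of \<open>m\<close>, so
  \<open>p ^ ?v\<close> divides one of them. If \<open>r = p\<close>, then \<open>?v\<close> is at
  most \<open>multiplicity p m - 1\<close>; otherwise \<open>p ^ ?v\<close> divides
  \<open>r - 1\<close>, which is smaller than \<open>p ^ multiplicity p m\<close> by
  maximality.\<close>

lemma multiplicity_Carmichael_less:
  assumes p: "p \<in> prime_factors m"
    and max: "\<And>r. r \<in> prime_factors m \<Longrightarrow> r \<le> p ^ multiplicity p m"
  shows "multiplicity p (Carmichael m) < multiplicity p m"
proof (cases "multiplicity p (Carmichael m) = 0")
  case True
  thus ?thesis using p by (simp add: prime_factors_multiplicity)
next
  case False
  let ?v = "multiplicity p (Carmichael m)"
  let ?f = "\<lambda>r. let k = multiplicity r m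
              in if r = 2 \<and> k > 2 then 2 ^ (k - 2) else r ^ (k - 1) * (r - 1)"
  have pr: "prime p" using p by auto
  have "0 \<notin> ?f ` prime_factors m"
    using prime_gt_Suc_0_nat[OF in_prime_factors_imp_prime]
    by (force simp: Let_def not_le[symmetric] split: if_splits)
  moreover have "p ^ ?v dvd Lcm (?f ` prime_factors m)"
    using multiplicity_dvd[of p "Carmichael m"] Carmichael_closed_formula[of m] by simp
  ultimately obtain r where r: "r \<in> prime_factors m" "p ^ ?v dvd ?f r"
    using prime_power_dvd_LcmD[of "?f ` prime_factors m" p ?v] False pr by auto
  let ?k = "multiplicity r m"
  have rp: "prime r" using r by auto
  \<comment> \<open>The exceptional value \<open>2 ^ (?k - 2)\<close> divides the generic one, so
    both cases of the formula are treated at once.\<close>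
  have "?f r dvd r ^ (?k - 1) * (r - 1)"
    by (auto simp: Let_def intro!: le_imp_power_dvd)
  with r have dvd: "p ^ ?v dvd r ^ (?k - 1) * (r - 1)"
    using dvd_trans by blast
  show ?thesis
  proof (cases "r = p")
    case True
    have "\<not> p dvd p - 1"
      using prime_gt_1_nat[OF pr] by (simp add: nat_dvd_not_less)
    have "p ^ ?v dvd p ^ (multiplicity p m - 1)"
    proof (rule prime_power_dvd_multD)
      show "\<not> p dvd p - 1" by fact
      show "p ^ ?v dvd (p - 1) * p ^ (multiplicity p m - 1)"
        using dvd unfolding True by (simp only: mult.commute)
    qed (use False pr in auto)
    hence "?v \<le> multiplicity p m - 1"
      using pr prime_gt_1_nat by (meson power_dvd_imp_le)
    moreover have "multiplicity p m > 0" using p by (simp add: prime_factors_multiplicity)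
    ultimately show ?thesis by linarith
  next
    case False
    hence ndvd: "\<not> p dvd r ^ (?k - 1)"
      using primes_dvd_imp_eq[OF pr rp] prime_dvd_power[OF pr, of r] by auto
    have "p ^ ?v dvd r - 1"
      using pr \<open>?v \<noteq> 0\<close> by (intro prime_power_dvd_multD[OF _ dvd _ ndvd]) auto
    hence "p ^ ?v \<le> r - 1"
      using prime_gt_1_nat[OF rp] by (intro dvd_imp_le) auto
    also have "\<dots> < r" using prime_gt_1_nat[OF rp] by simp
    also have "r \<le> p ^ multiplicity p m" using max r by simp
    finally show ?thesis
      using prime_gt_1_nat[OF pr] by (simp add: power_strict_increasing_iff)
  qed
qed

section \<open>Counting the elements of \<open>T m\<close>\<close>

lemma card_coprime_residues:
  assumes "k > 0"
  shows "card {x \<in> {0..<int k}. coprime x (int k)} = totient k"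
\<comment> \<open>\<open>totatives k\<close> runs over 1 to \<open>k\<close>, the residues over 0 to
  \<open>k - 1\<close>; the coprime elements differ only for \<open>k = 1\<close>.\<close>
proof (cases "k = 1")
  case True
  hence "{x \<in> {0..<int k}. coprime x (int k)} = {0}" by auto
  thus ?thesis using True by simp
next
  case False
  hence "k > 1" using assms by simp
  hence "{x \<in> {0..<int k}. coprime x (int k)} = int ` totatives k"
  proof (intro equalityI subsetI, goal_cases)
    case (1 x)
    then obtain y where y: "x = int y" using nonneg_int_cases by auto
    with 1 have "y \<noteq> 0" using \<open>k > 1\<close> by (intro notI) simp
    thus ?case using 1 unfolding y by (auto simp: in_totatives_iff)
  next
    case (2 x)
    thus ?case using totatives_less[of _ k] by (auto simp: in_totatives_iff)
  qed
  thus ?thesis by (simp add: card_image totient_def)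
qed

lemma square_dvd_power_Carmichael_minus_1:
  assumes "a \<in> T m"
  shows "(int m)\<^sup>2 dvd a ^ Carmichael m - 1"
proof -
  have "m \<ge> 2" "coprime (int m) a" "int m dvd Carmichael_quotient m a"
    using assms by (auto simp: T_def Carmichael_Wieferich_def cong_0_iff)
  thus ?thesis
    by (metis Carmichael_quotient_mult mult_dvd_mono dvd_refl power2_eq_square)
qed

text \<open>An element of \<open>T m\<close> is determined by its residue modulo \<open>q\<close>,
  its residue modulo n^2, and the block of length \<open>D\<close> containing it. Equal residues
  modulo \<open>q\<close> force agreement modulo \<open>p ^ (2 * \<alpha> - v)\<close> by lifting
  the exponent; with agreement modulo n^2 this gives agreement modulo \<open>D\<close>. Taking
  \<open>q = 4\<close> for \<open>p = 2\<close> meets the stronger hypothesis of lifting the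
  exponent there.\<close>

lemma card_T_le:
  assumes m: "m = p ^ \<alpha> * n" and p: "prime p" "\<not> p dvd n" and "m \<ge> 2"
    and \<alpha>: "\<alpha> > 0" and v: "multiplicity p (Carmichael m) \<le> 2 * \<alpha>"
  shows "card (T m) \<le> (if p = 2 then 4 else p) * totient (n\<^sup>2) * p ^ multiplicity p (Carmichael m)"
proof -
  define v where "v = multiplicity p (Carmichael m)"
  define q where "q = (if p = 2 then 4 else p)"
  \<comment> \<open>\<open>D\<close> is m^2 divided by \<open>p ^ v\<close>, so the range from 1 to
    m^2 consists of \<open>p ^ v\<close> blocks of length \<open>D\<close>.\<close>
  define D where "D = int (p ^ (2 * \<alpha> - v) * n\<^sup>2)"
  have n: "n > 0" using \<open>m \<ge> 2\<close> m by (intro Nat.gr0I) auto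
  have p0: "p > 0" using p prime_gt_0_nat by auto
  have D: "D > 0" using n p0 by (simp add: D_def)
  have mD: "(int m)\<^sup>2 = D * int (p ^ v)"
  proof -
    have "p ^ (2 * \<alpha>) = p ^ (2 * \<alpha> - v) * p ^ v"
      using v by (simp add: v_def flip: power_add)
    hence "m\<^sup>2 = p ^ (2 * \<alpha> - v) * n\<^sup>2 * p ^ v"
      by (simp add: m power_mult_distrib mult_ac flip: power_mult)
    hence "int (m\<^sup>2) = int (p ^ (2 * \<alpha> - v) * n\<^sup>2 * p ^ v)" by presburger
    thus ?thesis by (simp add: D_def)
  qed
  let ?R = "{x \<in> {0..<int (n\<^sup>2)}. coprime x (int (n\<^sup>2))}"
  let ?B = "{0..<int q} \<times> ?R \<times> {0..<int (p ^ v)}"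
  \<comment> \<open>The shift to \<open>a - 1\<close> places the endpoint \<open>a = m^2\<close> in
    the last block instead of a new one.\<close>
  let ?g = "\<lambda>a. (a mod int q, a mod int (n\<^sup>2), (a - 1) div D)"
  have q: "q > 0" using p0 by (simp add: q_def)
  have inj: "inj_on ?g (T m)"
  proof (rule inj_onI)
    fix a b assume ab: "a \<in> T m" "b \<in> T m" "?g a = ?g b"
    have qd: "int q dvd a - b" and nd: "int (n\<^sup>2) dvd a - b"
      using ab(3) by (auto simp: mod_eq_dvd_iff)
    have pd: "int p dvd a - b"
    proof -
      have "int p dvd int q" by (simp add: q_def)
      thus ?thesis using qd dvd_trans by blast
    qed
    have "coprime b (int m)"
      using ab(2) by (simp add: T_def coprime_iff_gcd_eq_1)
    moreover have "int p dvd int m" using m \<alpha> by auto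
    ultimately have pb: "\<not> int p dvd b"
      using p(1) coprime_common_divisor by (metis int_dvd_int_iff prime_nat_int_transfer not_prime_unit)
    have "(int m)\<^sup>2 dvd (a ^ Carmichael m - 1) - (b ^ Carmichael m - 1)"
      using ab by (intro dvd_diff square_dvd_power_Carmichael_minus_1)
    moreover have "int p ^ (2 * \<alpha>) dvd (int m)\<^sup>2"
      by (simp add: m power_mult_distrib flip: power_mult)
        (simp add: mult.commute)
    ultimately have "int p ^ (2 * \<alpha>) dvd a ^ Carmichael m - b ^ Carmichael m"
      using dvd_trans by fastforce
    hence "int p ^ (2 * \<alpha> - v) dvd a - b"
      unfolding v_def using qd pd pb p(1) by (intro lifting_the_exponent) (auto simp: q_def)
    moreover have "coprime (int p ^ (2 * \<alpha> - v)) (int (n\<^sup>2))"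
      using p by (simp add: prime_imp_coprime)
    ultimately have "D dvd a - b"
      using nd unfolding D_def by (simp add: divides_mult)
    hence "(a - 1) mod D = (b - 1) mod D"
      by (simp add: mod_eq_dvd_iff)
    moreover have "(a - 1) div D = (b - 1) div D" using ab(3) by simp
    ultimately have "a - 1 = b - 1"
      by (metis div_mult_mod_eq)
    thus "a = b" by simp
  qed
  have "finite ?R"
    by (rule finite_subset[of _ "{0..<int (n\<^sup>2)}"]) auto
  have "?g a \<in> ?B" if "a \<in> T m" for a
  proof -
    have a: "1 \<le> a" "a \<le> D * int (p ^ v)" "coprime a (int m)"
      using that mD by (auto simp: T_def coprime_iff_gcd_eq_1)
    have "coprime a (int (n\<^sup>2))" using a(3) by (simp add: m)
    hence "coprime (a mod int (n\<^sup>2)) (int (n\<^sup>2))"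
      using n by (subst coprime_mod_left_iff) auto
    moreover have "(a - 1) div D < int (p ^ v)"
      proof -
      have "D * ((a - 1) div D) \<le> a - 1"
        using D by (metis mult.commute div_mult_mod_eq pos_mod_sign le_add_same_cancel1)
      hence "D * ((a - 1) div D) < D * int (p ^ v)" using a(2) by linarith
      thus ?thesis using D by simp
    qed
    moreover have "0 \<le> (a - 1) div D"
      using a D by (simp add: pos_imp_zdiv_nonneg_iff)
    ultimately show ?thesis using n q by (simp del: of_nat_power coprime_power_right_iff)
  qed
  hence "card (T m) \<le> card ?B"
    using inj \<open>finite ?R\<close> by (intro card_inj_on_le[of ?g] finite_cartesian_product image_subsetI) blast+
  also have "card ?B = q * (totient (n\<^sup>2) * p ^ v)"
    using n by (simp only: card_cartesian_product card_coprime_residues zero_less_power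
      card_atLeastLessThan_int diff_zero nat_int)
  finally show ?thesis by (simp add: q_def v_def mult.assoc)
qed

text \<open>Since \<open>totient (m^2)\<close> equals
  \<open>p ^ (2 * \<alpha> - 1) * (p - 1) * totient (n^2)\<close>, the factor
  \<open>totient (n^2)\<close> cancels against the bound on \<open>card (T m)\<close>;
  \<open>v < \<alpha>\<close> then leaves a saving of \<open>p ^ \<alpha>\<close>.\<close>

lemma card_T_ratio_le:
  assumes p: "p \<in> prime_factors m" and "m \<ge> 2"
    and max: "\<And>r. r \<in> prime_factors m \<Longrightarrow> r \<le> p ^ multiplicity p m"
  shows "real (card (T m)) / real (totient (m\<^sup>2)) \<le> 4 / real (p ^ multiplicity p m)"
proof -
  define \<alpha> where "\<alpha> = multiplicity p m"
  define v where "v = multiplicity p (Carmichael m)"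
  have pr: "prime p" using p by auto
  have p1: "p > 1" using pr prime_gt_1_nat by auto
  have v: "v < \<alpha>"
    unfolding v_def \<alpha>_def using multiplicity_Carmichael_less[OF p max] by simp
  obtain n where n: "m = p ^ \<alpha> * n" "\<not> p dvd n"
    using multiplicity_decompose'[of m p] \<open>m \<ge> 2\<close> pr unfolding \<alpha>_def
    by (metis not_prime_unit not_numeral_le_zero)
  let ?q = "if p = 2 then 4 else p"
  \<comment> \<open>The constant 4 comes from \<open>p = 2\<close>, where equality holds.\<close>
  have q: "?q \<le> 4 * (p - 1)" using p1 by auto
  have "card (T m) * p ^ \<alpha> \<le> (?q * totient (n\<^sup>2) * p ^ v) * p ^ \<alpha>"
    using card_T_le[OF n(1) pr n(2)] \<open>m \<ge> 2\<close> v by (simp add: v_def)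
  also have "\<dots> \<le> (4 * (p - 1) * totient (n\<^sup>2) * p ^ (\<alpha> - 1)) * p ^ \<alpha>"
    using q v p1 by (intro mult_mono power_increasing) auto
  also have "\<dots> = 4 * (p ^ (2 * \<alpha> - 1) * (p - 1) * totient (n\<^sup>2))"
  proof -
    have "p ^ (2 * \<alpha> - 1) = p ^ (\<alpha> - 1) * p ^ \<alpha>"
      using v by (simp add: mult_2 flip: power_add)
    thus ?thesis by (simp add: mult_ac)
  qed
  also have "p ^ (2 * \<alpha> - 1) * (p - 1) * totient (n\<^sup>2) = totient (p ^ (2 * \<alpha>)) * totient (n\<^sup>2)"
    using pr v by (simp add: totient_prime_power)
  also have "\<dots> = totient (p ^ (2 * \<alpha>) * n\<^sup>2)"
    using pr n(2) by (intro totient_mult_coprime[symmetric]) (simp add: prime_imp_coprime)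
  also have "p ^ (2 * \<alpha>) * n\<^sup>2 = m\<^sup>2"
    by (simp add: n(1) power_mult_distrib mult.commute flip: power_mult)
  finally have "real (card (T m) * p ^ \<alpha>) \<le> real (4 * totient (m\<^sup>2))"
    by (rule of_nat_mono)
  moreover have "totient (m\<^sup>2) > 0" "p ^ \<alpha> > 0" using \<open>m \<ge> 2\<close> p1 by auto
  ultimately show ?thesis
    unfolding \<alpha>_def by (simp add: field_simps)
qed

section \<open>Growth of the largest prime power component and the limit\<close>

text \<open>Let \<open>Q\<close> be the largest prime power component. Each prime factor is at most
  its own component, hence at most \<open>Q\<close>, so there are at most \<open>Q\<close> of them;
  \<open>m\<close> is thus a product of at most \<open>Q\<close> components, each at most
  \<open>Q\<close>.\<close>

lemma exists_max_prime_power_component: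
  fixes m :: nat
  assumes "m \<ge> 2"
  obtains p where "p \<in> prime_factors m"
    "\<And>r. r \<in> prime_factors m \<Longrightarrow> r \<le> p ^ multiplicity p m"
    "m \<le> (p ^ multiplicity p m) ^ (p ^ multiplicity p m)"
proof -
  let ?f = "\<lambda>r. r ^ multiplicity r m"
  have ne: "prime_factors m \<noteq> {}"
    using assms by (auto simp: prime_factorization_empty_iff)
  define Q where "Q = Max (?f ` prime_factors m)"
  have "Q \<in> ?f ` prime_factors m" unfolding Q_def using ne by (intro Max_in) auto
  then obtain p where p: "p \<in> prime_factors m" "Q = ?f p" by auto
  have le: "?f r \<le> Q" if "r \<in> prime_factors m" for r
    unfolding Q_def using that by (intro Max_ge) auto
  have rle: "r \<le> Q" if "r \<in> prime_factors m" for r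
  proof -
    have "r ^ 1 \<le> ?f r"
      using that prime_ge_1_nat
      by (intro power_increasing) (auto simp: prime_factors_multiplicity)
    with le[OF that] show ?thesis by simp
  qed
  have "Q \<ge> 1"
    using rle[OF p(1)] prime_ge_1_nat[OF in_prime_factors_imp_prime[OF p(1)]] by linarith
  have "prime_factors m \<subseteq> {1..Q}"
    using rle prime_ge_1_nat[OF in_prime_factors_imp_prime] by auto
  hence "card (prime_factors m) \<le> card {1..Q}"
    by (intro card_mono) auto
  hence card: "card (prime_factors m) \<le> Q" by simp
  have "m = (\<Prod>r\<in>prime_factors m. ?f r)"
    using assms by (intro prime_factorization_nat) auto
  also have "\<dots> \<le> (\<Prod>r\<in>prime_factors m. Q)"
    using le by (intro prod_mono) auto
  also have "\<dots> \<le> Q ^ Q"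
    using card \<open>Q \<ge> 1\<close> by (simp add: power_increasing)
  finally show ?thesis using that[of p] p rle by auto
qed

theorem proposition4p5:
  shows "(\<lambda>m::nat. real (card (T m)) / real (totient (m\<^sup>2))) \<longlonglongrightarrow> 0"
proof (rule LIMSEQ_I)
  fix e :: real assume "e > 0"
  obtain K :: nat where K: "4 / e < real K" using reals_Archimedean2 by blast
  have K0: "real K > 0" using K \<open>e > 0\<close> by (smt (verit) divide_pos_pos)
  show "\<exists>N. \<forall>m\<ge>N. norm (real (card (T m)) / real (totient (m\<^sup>2)) - 0) < e"
  proof (intro exI allI impI)
    \<comment> \<open>The term \<open>K ^ K\<close> forces the largest component above
      \<open>K\<close>, because \<open>Q ^ Q\<close> is monotone in \<open>Q\<close>; adding 2
      ensures that \<open>m\<close> is at least 2 and makes the comparison strict.\<close>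
    fix m assume m: "m \<ge> K ^ K + 2"
    hence "m \<ge> 2" by simp
    then obtain p where p: "p \<in> prime_factors m"
      "\<And>r. r \<in> prime_factors m \<Longrightarrow> r \<le> p ^ multiplicity p m"
      "m \<le> (p ^ multiplicity p m) ^ (p ^ multiplicity p m)"
      using exists_max_prime_power_component by metis
    let ?Q = "p ^ multiplicity p m"
    have "?Q > K"
    proof (rule ccontr)
      assume "\<not> ?Q > K"
      hence "?Q ^ ?Q \<le> K ^ K"
        using K0 by (intro order.trans[OF power_mono power_increasing]) auto
      with m p(3) show False by simp
    qed
    hence "real ?Q > real K" by (simp only: of_nat_less_iff)
    hence "4 / real ?Q < 4 / real K"
      using K0 by (intro divide_strict_left_mono mult_pos_pos) linarith+
    also have "4 / real K < e" using K K0 \<open>e > 0\<close> by (simp add: field_simps)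
    finally show "norm (real (card (T m)) / real (totient (m\<^sup>2)) - 0) < e"
      using card_T_ratio_le[OF p(1) \<open>m \<ge> 2\<close> p(2)] by simp
  qed
qed

end
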